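(* Let $\pi$ be an equitable partition of a $d$-regular directed graph $G$ on $2n$ vertices, and suppose that the corresponding quotient graph is $K_n^{\circlearrowleft}$, where $n=2^s$ for some integer $s\ge1$. Let $\widetilde U$ be the transition matrix of $K_n^{\circlearrowleft}$ defined in the context. Then the following hold. (i) At time $k=n$, perfect state transfer occurs between each basis state $e_{v_i}\otimes e_{v_j}$, $(v_i,v_j)\in\mathcal A(K_n^{\circlearrowleft})$, representing the walker on the arc $(v_i,v_j)$, and the basis state corresponding to its antipodal arc $(v_i,v_{j+n/2\bmod n})$. That is, for every $(v_i,v_j)\in\mathcal A(K_n^{\circlearrowleft})$, $$\Bigl|\bigl(\widetilde U^{\,n}\bigr)_{(v_i,\,v_{j+n/2\bmod n}),\,(v_i,\,v_j)}\Bigr|^2=1,$$ and hence the transfer fidelity is $\mathcal F=1$. (ii) $\widetilde U^{\,2n}=I_{n^2}$, and the period of $\widetilde U$ is exactly $2n$.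
   Context: A directed graph is $d$-regular if all in- and out-degrees equal $d$. A partition is equitable if every vertex of the $i$-th cell has the same number $b_{ij}$ of out-neighbours in the $j$-th cell; the quotient graph has adjacency matrix $(b_{ij})$. $K_n^{\circlearrowleft}$ is the complete digraph on vertices $v_0,\dots,v_{n-1}$ with a loop at every vertex (adjacency matrix the all-ones matrix $J_n$). Its arc set is $\mathcal A(K_n^{\circlearrowleft})=\{(v_i,v_j):i,j\in\mathbb Z_n\}$, and its degree is $d=n$. Let $\widetilde P$ be the $n\times n$ cyclic permutation matrix with $\widetilde P_{i,\,i+1\bmod n}=1$ and other entries $0$, so $J_n=I_n+\widetilde P+\dots+\widetilde P^{n-1}$. Define $$\widetilde Q=\frac1{\sqrt n}\begin{bmatrix}I_n\\\widetilde P\\\vdots\\\widetilde P^{n-1}\end{bmatrix}\in\mathbb R^{n^2\times n},\quad \widetilde S=\bigoplus_{k=0}^{n-1}\widetilde P^k,\quad \widetilde R=2\widetilde Q\widetilde Q^\top-I_{n^2},\quad \widetilde U=\widetilde S\widetilde R.$$ The space $\mathbb C^{n^2}=\mathbb C^n\otimes\mathbb C^n$ (first factor the block index) has the orthonormal basis $e_{v_i}\otimes e_{v_j}$, indexed by arcs. The period of $\widetilde U$ is the least positive integer $t$ with $\widetilde U^t=I$. *)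

theory Defs
  imports
    "HOL-Library.Disjoint_Sets"
    "Graph_Theory.Graph_Theory"
    "Jordan_Normal_Form.Conjugate"
    "Jordan_Normal_Form.Matrix"
begin

section \<open>Regular digraphs, equitable partitions and quotient graphs\<close>

text \<open>Directed graphs are finite and have no parallel arcs; loops are allowed.\<close>

definition regular_digraph :: "('a,'b) pre_digraph \<Rightarrow> nat \<Rightarrow> bool" where
  "regular_digraph G d \<longleftrightarrow>
     fin_digraph G \<and> nomulti_digraph G \<and>
     (\<forall>v\<in>verts G. in_degree G v = d \<and> out_degree G v = d)"

definition out_neighbours_in :: "('a,'b) pre_digraph \<Rightarrow> 'a \<Rightarrow> 'a set \<Rightarrow> 'a set" where
  "out_neighbours_in G u D = {v \<in> D. u \<rightarrow>\<^bsub>G\<^esub> v}"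

definition equitable_partition :: "('a,'b) pre_digraph \<Rightarrow> 'a set set \<Rightarrow> bool" where
  "equitable_partition G \<pi> \<longleftrightarrow>
     partition_on (verts G) \<pi> \<and>
     (\<forall>C\<in>\<pi>. \<forall>D\<in>\<pi>. \<exists>b. \<forall>u\<in>C. card (out_neighbours_in G u D) = b)"

text \<open>The number \<open>b\<^sub>i\<^sub>j\<close> for the cells \<open>C = C\<^sub>i\<close>, \<open>D = C\<^sub>j\<close>.  It is well defined for an equitable
  partition, since the cells of a partition are nonempty.\<close>

definition quotient_entry :: "('a,'b) pre_digraph \<Rightarrow> 'a set \<Rightarrow> 'a set \<Rightarrow> nat" where
  "quotient_entry G C D = (THE b. \<forall>u\<in>C. card (out_neighbours_in G u D) = b)"

text \<open>The vertices are the cells, and there are \<open>quotient_entry G C D\<close> parallel arcs from \<open>C\<close> to \<open>D\<close>,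
  so that the adjacency matrix is \<open>(b\<^sub>i\<^sub>j)\<close>.\<close>

definition quotient_graph ::
    "('a,'b) pre_digraph \<Rightarrow> 'a set set \<Rightarrow> ('a set, 'a set \<times> 'a set \<times> nat) pre_digraph" where
  "quotient_graph G \<pi> =
     \<lparr> verts = \<pi>,
       arcs = {(C, D, k). C \<in> \<pi> \<and> D \<in> \<pi> \<and> k < quotient_entry G C D},
       tail = (\<lambda>(C, D, k). C),
       head = (\<lambda>(C, D, k). D) \<rparr>"

text \<open>\<open>K\<^sub>n\<close> with a loop at every vertex; the vertex \<open>v\<^sub>i\<close> is the number \<open>i\<close>.\<close>

definition complete_loop_digraph :: "nat \<Rightarrow> (nat, nat \<times> nat) pre_digraph" where
  "complete_loop_digraph n =
     \<lparr> verts = {..<n}, arcs = {..<n} \<times> {..<n}, tail = fst, head = snd \<rparr>"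

section \<open>The transition matrix of the complete digraph with loops\<close>

definition cyclic_perm_mat :: "nat \<Rightarrow> complex mat" where
  "cyclic_perm_mat n = mat n n (\<lambda>(i, j). if j = (i + 1) mod n then 1 else 0)"

text \<open>The \<open>k\<close>-th block of rows is \<open>1 / sqrt n\<close> times the \<open>k\<close>-th power of the cyclic permutation
  matrix.\<close>

definition Q_mat :: "nat \<Rightarrow> complex mat" where
  "Q_mat n = complex_of_real (1 / sqrt (real n)) \<cdot>\<^sub>m
     mat (n ^ 2) n (\<lambda>(r, c). (cyclic_perm_mat n ^\<^sub>m (r div n)) $$ (r mod n, c))"

definition S_mat :: "nat \<Rightarrow> complex mat" where
  "S_mat n = diag_block_mat (map (\<lambda>k. cyclic_perm_mat n ^\<^sub>m k) [0..<n])"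

definition R_mat :: "nat \<Rightarrow> complex mat" where
  "R_mat n = 2 \<cdot>\<^sub>m (Q_mat n * transpose_mat (Q_mat n)) - 1\<^sub>m (n ^ 2)"

definition transition_mat :: "nat \<Rightarrow> complex mat" where
  "transition_mat n = S_mat n * R_mat n"

section \<open>States, transfer fidelity and period\<close>

definition tensor_vec :: "complex vec \<Rightarrow> complex vec \<Rightarrow> complex vec" where
  "tensor_vec u v =
     vec (dim_vec u * dim_vec v) (\<lambda>r. u $ (r div dim_vec v) * v $ (r mod dim_vec v))"

fun arc_state :: "nat \<Rightarrow> nat \<times> nat \<Rightarrow> complex vec" where
  "arc_state n (i, j) = tensor_vec (unit_vec n i) (unit_vec n j)"

text \<open>Position of an arc in the basis, the tail being the block index:
  \<open>arc_state n a = unit_vec (n ^ 2) (arc_index n a)\<close> for every arc \<open>a\<close>.\<close>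

fun arc_index :: "nat \<Rightarrow> nat \<times> nat \<Rightarrow> nat" where
  "arc_index n (i, j) = i * n + j"

fun antipodal_arc :: "nat \<Rightarrow> nat \<times> nat \<Rightarrow> nat \<times> nat" where
  "antipodal_arc n (i, j) = (i, (j + n div 2) mod n)"

definition transfer_fidelity :: "complex mat \<Rightarrow> nat \<Rightarrow> complex vec \<Rightarrow> complex vec \<Rightarrow> real" where
  "transfer_fidelity U k \<phi> \<psi> = (cmod (((U ^\<^sub>m k) *\<^sub>v \<phi>) \<bullet>c \<psi>))\<^sup>2"

definition perfect_state_transfer :: "complex mat \<Rightarrow> nat \<Rightarrow> complex vec \<Rightarrow> complex vec \<Rightarrow> bool" where
  "perfect_state_transfer U k \<phi> \<psi> \<longleftrightarrow> transfer_fidelity U k \<phi> \<psi> = 1"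

text \<open>Only meaningful if some positive power of \<open>U\<close> is the identity.\<close>

definition mat_period :: "complex mat \<Rightarrow> nat" where
  "mat_period U = (LEAST t. 0 < t \<and> U ^\<^sub>m t = 1\<^sub>m (dim_row U))"

end

(* Let w = exp(2 pi i / n) and let x(a,m) be the wave on C^n (x) C^n whose entry at the arc
   (v_k, v_j) is w^(a k + m j).  The columns of Q span the arc functions that depend on k + j only, so
   the reflection R fixes x(a,m) if a = m mod n and negates it otherwise, while S maps x(a,m) to
   x(a + m, m).  Hence U permutes the waves up to sign, and U^n x(a,m) = e x(a,m), where e is the
   product of n signs along a, a + m, ..., a + (n - 1) m.  For odd m this progression meets m exactly
   once modulo n = 2^s, so e = (-1)^(n - 1) = -1; for even m it has period n/2, so e is a square and
   equals 1.  The shift j -> j + n/2 within the blocks also multiplies x(a,m) by (-1)^m.  The waves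
   are a basis, so U^n is that shift. *)
theory Submission
  imports Defs "HOL-Number_Theory.Cong"
begin

section \<open>Arc indices, finite sums and matrix-vector products\<close>

lemma arc_index_less_square:
  fixes i j n :: nat
  assumes "i < n" "j < n"
  shows "i * n + j < n ^ 2"
proof -
  have "i * n + j < Suc i * n" using assms by simp
  also have "\<dots> \<le> n * n" using assms by (intro mult_right_mono) auto
  finally show ?thesis by (simp add: power2_eq_square)
qed

lemma div_less_of_less_square:
  fixes r n :: nat
  shows "r < n ^ 2 \<Longrightarrow> r div n < n"
  by (simp add: less_mult_imp_div_less power2_eq_square)

lemma mod_less_of_less_square:
  fixes r n :: nat
  shows "r < n ^ 2 \<Longrightarrow> r mod n < n"
  by (cases "n = 0") auto

lemma sum_less_square_eq_double_sum:
  fixes f :: "nat \<Rightarrow> 'a :: comm_monoid_add"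
  shows "(\<Sum>r<n ^ 2. f r) = (\<Sum>k<n. \<Sum>j<n. f (k * n + j))"
  unfolding sum.cartesian_product
  by (rule sum.reindex_bij_witness[of _ "\<lambda>(k, j). k * n + j" "\<lambda>r. (r div n, r mod n)"])
    (auto simp: arc_index_less_square div_less_of_less_square mod_less_of_less_square)

lemma sum_rotate3:
  fixes f :: "'a \<Rightarrow> 'b \<Rightarrow> 'c \<Rightarrow> 'd :: comm_monoid_add"
  shows "(\<Sum>a\<in>A. \<Sum>b\<in>B. \<Sum>c\<in>C. f a b c) = (\<Sum>c\<in>C. \<Sum>a\<in>A. \<Sum>b\<in>B. f a b c)"
proof -
  have "(\<Sum>a\<in>A. \<Sum>b\<in>B. \<Sum>c\<in>C. f a b c) = (\<Sum>a\<in>A. \<Sum>c\<in>C. \<Sum>b\<in>B. f a b c)"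
    by (intro sum.cong refl sum.swap)
  also have "\<dots> = (\<Sum>c\<in>C. \<Sum>a\<in>A. \<Sum>b\<in>B. f a b c)"
    by (rule sum.swap)
  finally show ?thesis .
qed

text \<open>Serves Fourier inversion on matrices, where the two sums over wave parameters have to
  pass inside the two sums over arcs.\<close>

lemma sum_swap_pairs:
  fixes f :: "'a \<Rightarrow> 'b \<Rightarrow> 'c \<Rightarrow> 'd \<Rightarrow> 'e :: comm_monoid_add"
  shows "(\<Sum>a\<in>A. \<Sum>b\<in>B. \<Sum>c\<in>C. \<Sum>d\<in>D. f a b c d)
    = (\<Sum>c\<in>C. \<Sum>d\<in>D. \<Sum>a\<in>A. \<Sum>b\<in>B. f a b c d)"
  by (subst sum_rotate3) (intro sum.cong refl sum_rotate3)

lemma index_mult_mat_vec_sum: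
  assumes "A \<in> carrier_mat nr nc" "v \<in> carrier_vec nc" "i < nr"
  shows "(A *\<^sub>v v) $ i = (\<Sum>j<nc. A $$ (i, j) * v $ j)"
  using assms by (auto simp: scalar_prod_def row_def lessThan_atLeast0 intro!: sum.cong)

lemma smult_mat_mult_vec:
  fixes k :: "'a :: comm_semiring_0"
  assumes "A \<in> carrier_mat nr nc" "v \<in> carrier_vec nc"
  shows "(k \<cdot>\<^sub>m A) *\<^sub>v v = k \<cdot>\<^sub>v (A *\<^sub>v v)"
  by (rule eq_vecI) (use assms in \<open>auto simp: scalar_prod_def sum_distrib_left mult.assoc intro!: sum.cong\<close>)

section \<open>Additive characters modulo \<open>n\<close>\<close>

text \<open>This is w^z for w = exp(2 pi i / n). The exponent is an integer, not a natural number,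
  so that differences of wave parameters and inverse characters need no side conditions.\<close>

definition unity_char :: "nat \<Rightarrow> int \<Rightarrow> complex" where
  "unity_char n z = cis (2 * pi * of_int z / of_nat n)"

lemma unity_char_add: "unity_char n (x + y) = unity_char n x * unity_char n y"
  by (simp add: unity_char_def cis_mult add_divide_distrib distrib_left)

lemma unity_char_0 [simp]: "unity_char n 0 = 1"
  by (simp add: unity_char_def)

lemma unity_char_mult: "unity_char n (int l * z) = unity_char n z ^ l"
  by (simp add: unity_char_def DeMoivre mult_ac)

lemma unity_char_eq_1_iff:
  assumes "n > 0"
  shows "unity_char n z = 1 \<longleftrightarrow> int n dvd z"
proof -
  have "unity_char n z = 1 \<longleftrightarrow> (\<exists>k. 2 * pi * of_int z / of_nat n = of_int k * (2 * pi))"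
    using cos_one_2pi_int cos_one_sin_zero
    by (simp add: unity_char_def complex_eq_iff mult.assoc) blast
  also have "\<dots> \<longleftrightarrow> (\<exists>k. (of_int z :: real) = of_int (int n * k))"
    using assms by (simp add: field_simps)
  also have "\<dots> \<longleftrightarrow> int n dvd z"
    by (simp only: of_int_eq_iff dvd_def)
  finally show ?thesis .
qed

lemma unity_char_cong:
  assumes "n > 0" "int n dvd x - y"
  shows "unity_char n x = unity_char n y"
  using unity_char_add[of n "x - y" y] unity_char_eq_1_iff[OF assms(1)] assms(2) by simp

lemma unity_char_mult_mod:
  assumes "n > 0"
  shows "unity_char n (m * int (x mod n)) = unity_char n (m * int x)"
  using assms by (intro unity_char_cong)
    (auto simp: zmod_int mod_eq_dvd_iff[symmetric] mod_mult_right_eq)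

text \<open>A geometric sum with ratio w^z. The ratio is an \<open>n\<close>-th root of unity, so
  the sum vanishes unless the ratio is 1.\<close>

lemma sum_unity_char:
  assumes "n > 0"
  shows "(\<Sum>l<n. unity_char n (int l * z)) = (if int n dvd z then of_nat n else 0)"
proof (cases "int n dvd z")
  case True
  then have "unity_char n z = 1" using unity_char_eq_1_iff[OF assms] by simp
  then show ?thesis using True by (simp add: unity_char_mult)
next
  case False
  then have "unity_char n z \<noteq> 1" using unity_char_eq_1_iff[OF assms] by simp
  moreover have "unity_char n z ^ n = 1"
    unfolding unity_char_mult[symmetric] using unity_char_eq_1_iff[OF assms] by simp
  ultimately show ?thesis using False by (simp add: unity_char_mult sum_gp_strict)
qed

section \<open>Powers of the cyclic permutation matrix and block diagonal matrices\<close>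

lemma cyclic_perm_mat_carrier [simp]: "cyclic_perm_mat n \<in> carrier_mat n n"
  by (simp add: cyclic_perm_mat_def)

lemma index_cyclic_perm_mat_pow:
  assumes "i < n" "j < n"
  shows "(cyclic_perm_mat n ^\<^sub>m k) $$ (i, j) = of_bool (j = (i + k) mod n)"
  using assms(2)
proof (induction k arbitrary: j)
  case 0
  then show ?case using assms(1) by (auto simp: cyclic_perm_mat_def)
next
  case (Suc k)
  have "(cyclic_perm_mat n ^\<^sub>m Suc k) $$ (i, j)
      = (\<Sum>l<n. (cyclic_perm_mat n ^\<^sub>m k) $$ (i, l) * cyclic_perm_mat n $$ (l, j))"
    using Suc.prems assms(1)
    by (simp add: scalar_prod_def row_def col_def lessThan_atLeast0
        pow_mat_dim_square[OF cyclic_perm_mat_carrier] carrier_matD[OF cyclic_perm_mat_carrier])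
  also have "\<dots> = (\<Sum>l<n. of_bool (l = (i + k) mod n) * cyclic_perm_mat n $$ (l, j))"
    using Suc.IH by (intro sum.cong) auto
  also have "\<dots> = cyclic_perm_mat n $$ ((i + k) mod n, j)"
    using assms(1) by (simp add: of_bool_def if_distrib[of "\<lambda>x. x * _"] cong: if_cong)
  also have "\<dots> = of_bool (j = (i + Suc k) mod n)"
    using Suc.prems assms(1) by (simp add: cyclic_perm_mat_def mod_Suc_eq)
  finally show ?case .
qed

text \<open>Induction on the list of blocks: beyond the first block, subtracting \<open>n\<close>
  from an index lowers its quotient by one and keeps its remainder.\<close>

lemma index_diag_block_mat_uniform:
  assumes "\<And>A. A \<in> set As \<Longrightarrow> A \<in> carrier_mat n n"
    and "r < length As * n" "c < length As * n"
  shows "diag_block_mat As $$ (r, c) =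
    (if r div n = c div n then (As ! (r div n)) $$ (r mod n, c mod n) else 0)"
  using assms
proof (induction As arbitrary: r c)
  case Nil
  then show ?case by simp
next
  case (Cons A As)
  have A: "A \<in> carrier_mat n n" and As: "\<And>B. B \<in> set As \<Longrightarrow> B \<in> carrier_mat n n"
    using Cons.prems(1) by auto
  have n: "n > 0" using Cons.prems(2) by (cases n) auto
  have "map dim_row As = replicate (length As) n" "map dim_col As = replicate (length As) n"
    using carrier_matD[OF As] by (auto intro!: replicate_eqI)
  then have dims: "dim_row (diag_block_mat As) = length As * n"
      "dim_col (diag_block_mat As) = length As * n"
    by (simp_all add: dim_diag_block_mat sum_list_replicate)
  have shift: "x div n = Suc ((x - n) div n)" "x mod n = (x - n) mod n" if "\<not> x < n" for x
    using that n by (simp_all add: le_div_geq le_mod_geq)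
  have "diag_block_mat (A # As) $$ (r, c) =
      (if r < n then if c < n then A $$ (r, c) else 0
       else if c < n then 0 else diag_block_mat As $$ (r - n, c - n))"
    using Cons.prems(2,3) A n by (simp add: Let_def dims)
  moreover have "diag_block_mat As $$ (r - n, c - n) =
      (if (r - n) div n = (c - n) div n
       then (As ! ((r - n) div n)) $$ ((r - n) mod n, (c - n) mod n) else 0)"
    if "\<not> r < n" "\<not> c < n"
    using Cons.prems(2,3) that by (intro Cons.IH As) auto
  ultimately show ?case
    by (cases "r < n"; cases "c < n") (simp_all add: shift)
qed

section \<open>Cyclic shifts within the blocks\<close>

text \<open>The shift may depend on the block, so that one family covers both \<open>S_mat\<close>
  (\<open>f k = k\<close>) and the antipodal shift (\<open>f k = n div 2\<close>). Row (k, j) reads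
  the entry at (k, j + f k).\<close>

definition block_shift_mat :: "nat \<Rightarrow> (nat \<Rightarrow> nat) \<Rightarrow> complex mat" where
  "block_shift_mat n f = mat (n ^ 2) (n ^ 2)
     (\<lambda>(r, c). of_bool (c = r div n * n + (r mod n + f (r div n)) mod n))"

lemma block_shift_mat_carrier [simp]: "block_shift_mat n f \<in> carrier_mat (n ^ 2) (n ^ 2)"
  by (simp add: block_shift_mat_def)

lemma index_block_shift_mat_mult_vec:
  assumes "v \<in> carrier_vec (n ^ 2)" "r < n ^ 2"
  shows "(block_shift_mat n f *\<^sub>v v) $ r = v $ (r div n * n + (r mod n + f (r div n)) mod n)"
proof -
  have n: "n > 0" using assms(2) by (cases n) auto
  have lt: "r div n * n + (r mod n + f (r div n)) mod n < n ^ 2"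
    using n assms(2) by (intro arc_index_less_square div_less_of_less_square) auto
  have "(block_shift_mat n f *\<^sub>v v) $ r = (\<Sum>c<n ^ 2. block_shift_mat n f $$ (r, c) * v $ c)"
    using assms by (intro index_mult_mat_vec_sum) auto
  also have "\<dots> = (\<Sum>c<n ^ 2. of_bool (c = r div n * n + (r mod n + f (r div n)) mod n) * v $ c)"
    using assms(2) by (intro sum.cong) (auto simp: block_shift_mat_def)
  also have "\<dots> = v $ (r div n * n + (r mod n + f (r div n)) mod n)"
    using lt by (simp add: of_bool_def if_distrib[of "\<lambda>x. x * _"] cong: if_cong)
  finally show ?thesis .
qed

lemma S_mat_eq_block_shift_mat: "S_mat n = block_shift_mat n (\<lambda>k. k)"
proof (rule eq_matI)
  let ?As = "map (\<lambda>k. cyclic_perm_mat n ^\<^sub>m k) [0..<n]"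
  have carr: "A \<in> carrier_mat n n" if "A \<in> set ?As" for A
    using that by (auto intro!: pow_carrier_mat)
  have "map dim_row ?As = replicate n n" "map dim_col ?As = replicate n n"
    by (auto intro!: replicate_eqI simp: carrier_matD[OF cyclic_perm_mat_carrier])
  then show "dim_row (S_mat n) = dim_row (block_shift_mat n (\<lambda>k. k))"
      "dim_col (S_mat n) = dim_col (block_shift_mat n (\<lambda>k. k))"
    unfolding S_mat_def dim_diag_block_mat
    by (simp_all add: sum_list_replicate block_shift_mat_def power2_eq_square)
  fix r c assume "r < dim_row (block_shift_mat n (\<lambda>k. k))" "c < dim_col (block_shift_mat n (\<lambda>k. k))"
  then have rc: "r < n ^ 2" "c < n ^ 2" by (simp_all add: block_shift_mat_def)
  then have n: "n > 0" by (cases n) auto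
  have "S_mat n $$ (r, c) =
      (if r div n = c div n then (?As ! (r div n)) $$ (r mod n, c mod n) else 0)"
    unfolding S_mat_def using rc carr
    by (intro index_diag_block_mat_uniform) (auto simp: power2_eq_square)
  also have "\<dots> = of_bool (r div n = c div n \<and> c mod n = (r mod n + r div n) mod n)"
    using rc n by (simp add: index_cyclic_perm_mat_pow div_less_of_less_square)
  also have "r div n = c div n \<and> c mod n = (r mod n + r div n) mod n
      \<longleftrightarrow> c = r div n * n + (r mod n + r div n) mod n"
    using n by auto (metis div_mult_mod_eq)
  finally show "S_mat n $$ (r, c) = block_shift_mat n (\<lambda>k. k) $$ (r, c)"
    using rc by (simp add: block_shift_mat_def)
qed

section \<open>Waves and the action of \<open>S_mat\<close> and \<open>R_mat\<close> on them\<close>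

definition wave_vec :: "nat \<Rightarrow> int \<Rightarrow> int \<Rightarrow> complex vec" where
  "wave_vec n a m = vec (n ^ 2) (\<lambda>r. unity_char n (a * int (r div n) + m * int (r mod n)))"

lemma wave_vec_carrier [simp]: "wave_vec n a m \<in> carrier_vec (n ^ 2)"
  by (simp add: wave_vec_def)

lemma index_wave_vec:
  "k < n \<Longrightarrow> j < n \<Longrightarrow> wave_vec n a m $ (k * n + j) = unity_char n (a * int k + m * int j)"
  by (simp add: wave_vec_def arc_index_less_square)

lemma wave_vec_cong:
  assumes "int n dvd a - b"
  shows "wave_vec n a m = wave_vec n b m"
proof (rule eq_vecI)
  fix r assume "r < dim_vec (wave_vec n b m)"
  then have r: "r < n ^ 2" by (simp add: wave_vec_def)
  then have n: "n > 0" by (cases n) auto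
  have "a * x + y - (b * x + y) = (a - b) * x" for x y by (simp add: algebra_simps)
  then show "wave_vec n a m $ r = wave_vec n b m $ r"
    using r n assms by (auto simp: wave_vec_def intro!: unity_char_cong)
qed (simp add: wave_vec_def)

text \<open>The shift by \<open>f k\<close> in block k contributes the factor w^(m f(k)). If
  \<open>f\<close> is constant, the wave is therefore an eigenvector; if \<open>f k = k\<close>, the
  factor is absorbed by replacing \<open>a\<close> with \<open>a + m\<close>.\<close>

lemma block_shift_mat_mult_wave_vec:
  assumes "r < n ^ 2"
  shows "(block_shift_mat n f *\<^sub>v wave_vec n a m) $ r
    = unity_char n (m * int (f (r div n))) * wave_vec n a m $ r"
proof -
  have n: "n > 0" using assms by (cases n) auto
  have "(block_shift_mat n f *\<^sub>v wave_vec n a m) $ r =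
      unity_char n (a * int (r div n)) * unity_char n (m * int ((r mod n + f (r div n)) mod n))"
    using assms n div_less_of_less_square[OF assms]
    by (simp add: index_block_shift_mat_mult_vec index_wave_vec unity_char_add)
  also have "unity_char n (m * int ((r mod n + f (r div n)) mod n))
      = unity_char n (m * int (r mod n)) * unity_char n (m * int (f (r div n)))"
    unfolding unity_char_mult_mod[OF n, of m "r mod n + f (r div n)"]
    by (simp only: unity_char_add[symmetric] of_nat_add distrib_left)
  finally show ?thesis using assms by (simp add: wave_vec_def unity_char_add)
qed

lemma S_mat_mult_wave_vec: "S_mat n *\<^sub>v wave_vec n a m = wave_vec n (a + m) m"
proof (rule eq_vecI)
  fix r assume "r < dim_vec (wave_vec n (a + m) m)"
  then have r: "r < n ^ 2" by (simp add: wave_vec_def)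
  have "unity_char n (m * int (r div n)) * wave_vec n a m $ r = wave_vec n (a + m) m $ r"
    using r by (simp add: wave_vec_def unity_char_add distrib_right mult_ac)
  then show "(S_mat n *\<^sub>v wave_vec n a m) $ r = wave_vec n (a + m) m $ r"
    using r by (simp only: S_mat_eq_block_shift_mat block_shift_mat_mult_wave_vec)
qed (simp add: wave_vec_def S_mat_eq_block_shift_mat block_shift_mat_def)

lemma Q_mat_carrier [simp]: "Q_mat n \<in> carrier_mat (n ^ 2) n"
  by (simp add: Q_mat_def)

lemma index_Q_mat:
  assumes "k < n" "j < n" "i < n"
  shows "Q_mat n $$ (k * n + j, i) = of_real (1 / sqrt (real n)) * of_bool (i = (j + k) mod n)"
  using assms arc_index_less_square[OF assms(1,2)]
  by (simp add: Q_mat_def index_cyclic_perm_mat_pow)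

text \<open>Column i of \<open>Q_mat\<close> is supported on the arcs (k, j) with j + k = i modulo
  \<open>n\<close>, one in each block. There the wave has the value w^(m i) w^(k (a - m)), which
  leaves a character sum over k.\<close>

lemma index_Q_mat_transpose_mult_wave_vec:
  assumes "i < n"
  shows "(transpose_mat (Q_mat n) *\<^sub>v wave_vec n a m) $ i =
    of_real (1 / sqrt (real n)) * (if int n dvd a - m then of_nat n else 0) * unity_char n (m * int i)"
    (is "?lhs = ?q * _ * _")
proof -
  have n: "n > 0" using assms by simp
  have row: "(\<Sum>j<n. of_bool (i = (j + k) mod n) * wave_vec n a m $ (k * n + j))
      = unity_char n (m * int i) * unity_char n (int k * (a - m))" if k: "k < n" for k
  proof -
    \<comment> \<open>This is i - k modulo \<open>n\<close>, written with \<open>n - k\<close> to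
      avoid truncated subtraction on the naturals.\<close>
    let ?j0 = "(i + (n - k)) mod n"
    have iff: "i = (j + k) mod n \<longleftrightarrow> j = ?j0" if "j < n" for j
    proof
      assume "i = (j + k) mod n"
      then have "?j0 = (j + k + (n - k)) mod n" by (simp add: mod_add_left_eq)
      then show "j = ?j0" using that k by simp
    next
      assume "j = ?j0"
      then have "(j + k) mod n = (i + (n - k) + k) mod n" by (simp add: mod_add_left_eq)
      then show "i = (j + k) mod n" using k assms by simp
    qed
    have "(\<Sum>j<n. of_bool (i = (j + k) mod n) * wave_vec n a m $ (k * n + j))
        = (\<Sum>j<n. if j = ?j0 then wave_vec n a m $ (k * n + j) else 0)"
      using iff by (intro sum.cong) auto
    also have "\<dots> = wave_vec n a m $ (k * n + ?j0)" using n by simp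
    also have "\<dots> = unity_char n (a * int k) * unity_char n (m * int ?j0)"
      using k n by (simp add: index_wave_vec unity_char_add)
    also have "\<dots> = unity_char n (a * int k + m * int (i + (n - k)))"
      unfolding unity_char_mult_mod[OF n] by (simp only: unity_char_add)
    also have "\<dots> = unity_char n (m * int i + int k * (a - m))"
      using k n by (intro unity_char_cong) (auto simp: of_nat_diff algebra_simps)
    finally show ?thesis by (simp only: unity_char_add)
  qed
  have "?lhs = (\<Sum>r<n ^ 2. transpose_mat (Q_mat n) $$ (i, r) * wave_vec n a m $ r)"
    using assms by (intro index_mult_mat_vec_sum) (auto intro!: transpose_carrier_mat)
  also have "\<dots> = (\<Sum>k<n. \<Sum>j<n. transpose_mat (Q_mat n) $$ (i, k * n + j)
      * wave_vec n a m $ (k * n + j))"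
    by (rule sum_less_square_eq_double_sum)
  also have "\<dots> = (\<Sum>k<n. \<Sum>j<n. ?q *
      (of_bool (i = (j + k) mod n) * wave_vec n a m $ (k * n + j)))"
    using assms by (intro sum.cong)
      (auto simp: index_Q_mat arc_index_less_square carrier_matD[OF Q_mat_carrier])
  also have "\<dots> = (\<Sum>k<n. ?q * (unity_char n (m * int i) * unity_char n (int k * (a - m))))"
    by (intro sum.cong refl) (simp only: sum_distrib_left[symmetric] row lessThan_iff)
  also have "\<dots> = ?q * (unity_char n (m * int i) * (\<Sum>k<n. unity_char n (int k * (a - m))))"
    by (simp only: sum_distrib_left)
  finally show ?thesis using sum_unity_char[OF n] by simp
qed

text \<open>Q Q^T is the orthogonal projection onto the functions of k + j modulo \<open>n\<close>.
  A wave with a = m modulo \<open>n\<close> is such a function, and every other wave is annihilated,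
  so that 2 Q Q^T - I acts by 1 or -1.\<close>

lemma R_mat_mult_wave_vec:
  "R_mat n *\<^sub>v wave_vec n a m = (if int n dvd a - m then 1 else - 1) \<cdot>\<^sub>v wave_vec n a m"
proof (rule eq_vecI)
  let ?q = "complex_of_real (1 / sqrt (real n))"
  let ?w = "wave_vec n a m"
  fix r assume "r < dim_vec ((if int n dvd a - m then 1 else - 1) \<cdot>\<^sub>v ?w)"
  then have r: "r < n ^ 2" by (simp add: wave_vec_def)
  then have n: "n > 0" by (cases n) auto
  \<comment> \<open>The factors 1 / sqrt n of Q and of its transpose cancel the \<open>n\<close>
    that comes from the character sum.\<close>
  have q: "?q * ?q * of_nat n = 1"
  proof -
    have "?q * ?q * of_nat n = of_real (1 / sqrt (real n) * (1 / sqrt (real n)) * real n)"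
      by (simp only: of_real_mult of_real_of_nat_eq)
    also have "1 / sqrt (real n) * (1 / sqrt (real n)) * real n = 1" using n by simp
    finally show ?thesis by simp
  qed
  let ?k = "r div n" and ?j = "r mod n"
  have k: "?k < n" "?j < n" using r n div_less_of_less_square by auto
  have Qt: "transpose_mat (Q_mat n) \<in> carrier_mat n (n ^ 2)" by (simp add: transpose_carrier_mat)
  have "(Q_mat n *\<^sub>v (transpose_mat (Q_mat n) *\<^sub>v ?w)) $ r
      = (\<Sum>i<n. Q_mat n $$ (r, i) * (transpose_mat (Q_mat n) *\<^sub>v ?w) $ i)"
    by (rule index_mult_mat_vec_sum[OF Q_mat_carrier mult_mat_vec_carrier[OF Qt wave_vec_carrier] r])
  also have "\<dots> = (\<Sum>i<n. if i = (?j + ?k) mod n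
      then ?q * (transpose_mat (Q_mat n) *\<^sub>v ?w) $ i else 0)"
    using index_Q_mat[OF k] by (intro sum.cong) auto
  also have "\<dots> = ?q * (?q * (if int n dvd a - m then of_nat n else 0)
      * unity_char n (m * int ((?j + ?k) mod n)))"
    using n by (simp add: index_Q_mat_transpose_mult_wave_vec)
  also have "\<dots> = (if int n dvd a - m then 1 else 0) * unity_char n (m * int (?j + ?k))"
    unfolding unity_char_mult_mod[OF n] using q by (simp add: mult_ac)
  also have "\<dots> = (if int n dvd a - m then 1 else 0) * ?w $ r"
  proof (cases "int n dvd a - m")
    case True
    \<comment> \<open>With both parameters equal to \<open>m\<close>, the entry at (k, j) is w^(m (k
      + j)).\<close>
    have "wave_vec n m m $ r = ?w $ r" using wave_vec_cong[OF True] by simp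
    then show ?thesis using r by (simp add: wave_vec_def algebra_simps)
  qed simp
  finally have QQ: "(Q_mat n *\<^sub>v (transpose_mat (Q_mat n) *\<^sub>v ?w)) $ r
    = (if int n dvd a - m then 1 else 0) * ?w $ r" .
  have "Q_mat n * transpose_mat (Q_mat n) \<in> carrier_mat (n ^ 2) (n ^ 2)"
    using mult_carrier_mat[OF Q_mat_carrier Qt] .
  then have "R_mat n *\<^sub>v ?w = 2 \<cdot>\<^sub>v ((Q_mat n * transpose_mat (Q_mat n)) *\<^sub>v ?w) - ?w"
    unfolding R_mat_def
    by (simp add: minus_mult_distrib_mat_vec[OF smult_carrier_mat one_carrier_mat wave_vec_carrier]
        smult_mat_mult_vec[OF _ wave_vec_carrier])
  also have "(Q_mat n * transpose_mat (Q_mat n)) *\<^sub>v ?w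
      = Q_mat n *\<^sub>v (transpose_mat (Q_mat n) *\<^sub>v ?w)"
    by (rule assoc_mult_mat_vec[OF Q_mat_carrier Qt wave_vec_carrier])
  finally show "(R_mat n *\<^sub>v ?w) $ r = ((if int n dvd a - m then 1 else - 1) \<cdot>\<^sub>v ?w) $ r"
    using r QQ by (simp add: carrier_matD[OF Q_mat_carrier] carrier_vecD[OF wave_vec_carrier])
qed (simp add: R_mat_def wave_vec_def)

section \<open>Powers of the transition matrix on waves\<close>

lemma R_mat_carrier: "R_mat n \<in> carrier_mat (n ^ 2) (n ^ 2)"
  unfolding R_mat_def by (intro minus_carrier_mat) simp

lemma transition_mat_carrier [simp]: "transition_mat n \<in> carrier_mat (n ^ 2) (n ^ 2)"
  unfolding transition_mat_def S_mat_eq_block_shift_mat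
  by (rule mult_carrier_mat[OF block_shift_mat_carrier R_mat_carrier])

definition wave_sign :: "nat \<Rightarrow> int \<Rightarrow> int \<Rightarrow> complex" where
  "wave_sign n a m = (if int n dvd a - m then 1 else - 1)"

lemma transition_mat_mult_wave_vec:
  "transition_mat n *\<^sub>v wave_vec n a m = wave_sign n a m \<cdot>\<^sub>v wave_vec n (a + m) m"
proof -
  have S: "S_mat n \<in> carrier_mat (n ^ 2) (n ^ 2)" by (simp add: S_mat_eq_block_shift_mat)
  show ?thesis
    unfolding transition_mat_def assoc_mult_mat_vec[OF S R_mat_carrier wave_vec_carrier] R_mat_mult_wave_vec
      mult_mat_vec[OF S wave_vec_carrier] S_mat_mult_wave_vec wave_sign_def ..
qed

lemma transition_mat_pow_mult_wave_vec:
  "transition_mat n ^\<^sub>m t *\<^sub>v wave_vec n a m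
    = (\<Prod>i<t. wave_sign n (a + int i * m) m) \<cdot>\<^sub>v wave_vec n (a + int t * m) m"
proof (induction t arbitrary: a)
  case 0
  show ?case by (simp add: carrier_matD[OF transition_mat_carrier])
next
  case (Suc t)
  have U: "transition_mat n ^\<^sub>m t \<in> carrier_mat (n ^ 2) (n ^ 2)" by (rule pow_carrier_mat) simp
  \<comment> \<open>The extra factor of the power stands on the right and acts first, so the
    remaining \<open>t\<close> steps start from \<open>a + m\<close>; hence the induction is over
    all \<open>a\<close>.\<close>
  have "transition_mat n ^\<^sub>m Suc t *\<^sub>v wave_vec n a m
      = transition_mat n ^\<^sub>m t *\<^sub>v (wave_sign n a m \<cdot>\<^sub>v wave_vec n (a + m) m)"
    using assoc_mult_mat_vec[OF U transition_mat_carrier wave_vec_carrier]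
    by (simp add: transition_mat_mult_wave_vec)
  also have "\<dots> = wave_sign n a m \<cdot>\<^sub>v
      ((\<Prod>i<t. wave_sign n (a + m + int i * m) m) \<cdot>\<^sub>v wave_vec n (a + m + int t * m) m)"
    using mult_mat_vec[OF U wave_vec_carrier] Suc.IH by simp
  finally show ?case
    by (simp add: prod.lessThan_Suc_shift smult_smult_assoc algebra_simps del: prod.lessThan_Suc)
qed

section \<open>Products of signs along an arithmetic progression\<close>

text \<open>For m = 2 l and n = 2 h one has h m = n l, so the signs repeat after h steps. The
  product is the square of a product of signs.\<close>

lemma prod_wave_sign_even:
  assumes "even n" "even m"
  shows "(\<Prod>i<n. wave_sign n (a + int i * m) m) = 1"
proof -
  obtain h where h: "n = h + h" using assms(1) by (metis evenE mult_2)
  obtain l where l: "m = 2 * l" using assms(2) by (elim evenE)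
  let ?f = "\<lambda>i. wave_sign n (a + int i * m) m"
  have "?f (i + h) = ?f i" for i
  proof -
    have "a + int (i + h) * m - m = (a + int i * m - m) + int n * l"
      by (simp add: h l algebra_simps)
    then show ?thesis unfolding wave_sign_def by (simp only: dvd_add_left_iff dvd_triv_left)
  qed
  then have "(\<Prod>i<n. ?f i) = (\<Prod>i<h. ?f i) * (\<Prod>i<h. ?f i)"
    using prod.atLeastLessThan_concat[of 0 h n ?f] prod.shift_bounds_nat_ivl[of ?f 0 h h] h
    by (simp add: lessThan_atLeast0)
  also have "\<dots> = (\<Prod>i<h. ?f i * ?f i)" by (simp only: prod.distrib)
  also have "\<dots> = 1" unfolding wave_sign_def by (intro prod.neutral) simp
  finally show ?thesis .
qed

text \<open>As i runs through the residues modulo \<open>n\<close>, so does a + i m. Exactly one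
  term is congruent to m and has sign 1; the other n - 1 signs are -1, and n - 1 is odd.\<close>

lemma prod_wave_sign_coprime:
  assumes "even n" "n > 0" "coprime m (int n)"
  shows "(\<Prod>i<n. wave_sign n (a + int i * m) m) = - 1"
proof -
  let ?f = "\<lambda>i. wave_sign n (a + int i * m) m"
  obtain x where x: "[m * x = 1] (mod int n)"
    using cong_solve_coprime_int[OF assms(3)] by blast
  \<comment> \<open>The solution of a + i m = m modulo \<open>n\<close>, where \<open>x\<close> is
    the inverse of \<open>m\<close>.\<close>
  define i0 where "i0 = nat ((x * (m - a)) mod int n)"
  have i0: "int i0 = (x * (m - a)) mod int n" "i0 < n"
    using assms(2) by (auto simp: i0_def nat_less_iff)
  have "[int i0 * m = (m * x) * (m - a)] (mod int n)"
    unfolding i0(1) cong_def by (simp add: mod_mult_right_eq mult_ac)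
  also have "[(m * x) * (m - a) = 1 * (m - a)] (mod int n)"
    using x by (rule cong_scalar_right)
  finally have i0_dvd: "int n dvd a + int i0 * m - m"
    by (simp add: cong_iff_dvd_diff algebra_simps)
  have uniq: "i = i0" if "i < n" "int n dvd a + int i * m - m" for i
  proof -
    have "int n dvd (a + int i * m - m) - (a + int i0 * m - m)"
      using that(2) i0_dvd by (rule dvd_diff)
    then have "int n dvd (int i - int i0) * m" by (simp add: algebra_simps)
    then have "int n dvd int i - int i0"
      using assms(3) by (simp add: coprime_dvd_mult_left_iff coprime_commute)
    then have "[int i = int i0] (mod int n)" by (simp add: cong_iff_dvd_diff)
    then show ?thesis using that(1) i0(2) by (simp add: cong_int_iff cong_def)
  qed
  have "(\<Prod>i<n. ?f i) = ?f i0 * (\<Prod>i\<in>{..<n} - {i0}. ?f i)"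
    using i0(2) by (intro prod.remove) auto
  also have "(\<Prod>i\<in>{..<n} - {i0}. ?f i) = (\<Prod>i\<in>{..<n} - {i0}. - 1)"
    using uniq by (intro prod.cong) (auto simp: wave_sign_def)
  also have "\<dots> = - 1" using assms(1,2) i0(2) by simp
  finally show ?thesis using i0_dvd by (simp add: wave_sign_def)
qed

section \<open>A matrix is determined by its action on waves\<close>

text \<open>Fourier inversion on the product of two copies of the integers modulo \<open>n\<close>:
  weighting the images of the waves by the inverse characters at c and summing over both parameters
  isolates column c, up to the factor \<open>n ^ 2\<close>.\<close>

lemma mat_eq_if_wave_vecs_eq:
  assumes "A \<in> carrier_mat (n ^ 2) (n ^ 2)" "B \<in> carrier_mat (n ^ 2) (n ^ 2)"
    and "\<And>a m. A *\<^sub>v wave_vec n a m = B *\<^sub>v wave_vec n a m"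
  shows "A = B"
proof -
  have inv: "(\<Sum>a<n. \<Sum>m<n. unity_char n (- (int a * int (c div n) + int m * int (c mod n)))
      * (M *\<^sub>v wave_vec n (int a) (int m)) $ r) = of_nat (n ^ 2) * M $$ (r, c)"
    if M: "M \<in> carrier_mat (n ^ 2) (n ^ 2)" and rc: "r < n ^ 2" "c < n ^ 2" for M r c
  proof -
    have n: "n > 0" using rc by (cases n) auto
    let ?k = "c div n" and ?j = "c mod n"
    have lt: "?k < n" "?j < n" using rc n div_less_of_less_square by auto
    have orth: "(\<Sum>a<n. unity_char n (int a * (int x - int y))) = of_nat n * of_bool (x = y)"
      if "x < n" "y < n" for x y
    proof -
      have "int n dvd int x - int y \<longleftrightarrow> [int x = int y] (mod int n)"
        by (simp add: cong_iff_dvd_diff)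
      also have "\<dots> \<longleftrightarrow> x = y" using that by (simp add: cong_int_iff cong_def)
      finally show ?thesis using sum_unity_char[OF n] by simp
    qed
    have "(\<Sum>a<n. \<Sum>m<n. unity_char n (- (int a * int ?k + int m * int ?j))
        * (M *\<^sub>v wave_vec n (int a) (int m)) $ r)
      = (\<Sum>a<n. \<Sum>m<n. \<Sum>k<n. \<Sum>j<n. M $$ (r, k * n + j) *
        (unity_char n (int a * (int k - int ?k)) * unity_char n (int m * (int j - int ?j))))"
    proof (intro sum.cong refl)
      fix a m
      let ?u = "unity_char n (- (int a * int ?k + int m * int ?j))"
      \<comment> \<open>The inverse character at c times the wave at (k, j) splits into one factor
        in \<open>a\<close> and one in \<open>m\<close>; orthogonality then applies to each
        parameter separately.\<close>
      have eq: "?u * unity_char n (int a * int k + int m * int j)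
          = unity_char n (int a * (int k - int ?k)) * unity_char n (int m * (int j - int ?j))" for k j
        unfolding unity_char_add[symmetric] by (simp add: algebra_simps)
      have "(M *\<^sub>v wave_vec n (int a) (int m)) $ r
          = (\<Sum>k<n. \<Sum>j<n. M $$ (r, k * n + j) * wave_vec n (int a) (int m) $ (k * n + j))"
        using M rc by (simp only: index_mult_mat_vec_sum[OF M wave_vec_carrier rc(1)]
            sum_less_square_eq_double_sum)
      also have "\<dots> = (\<Sum>k<n. \<Sum>j<n. M $$ (r, k * n + j) *
          unity_char n (int a * int k + int m * int j))"
        by (intro sum.cong refl) (simp add: index_wave_vec)
      finally have "?u * (M *\<^sub>v wave_vec n (int a) (int m)) $ r
          = (\<Sum>k<n. \<Sum>j<n. M $$ (r, k * n + j) *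
              (?u * unity_char n (int a * int k + int m * int j)))"
        by (simp only: sum_distrib_left mult.left_commute)
      then show "?u * (M *\<^sub>v wave_vec n (int a) (int m)) $ r = (\<Sum>k<n. \<Sum>j<n. M $$ (r, k * n + j) *
        (unity_char n (int a * (int k - int ?k)) * unity_char n (int m * (int j - int ?j))))"
        by (simp only: eq)
    qed
    also have "\<dots> = (\<Sum>k<n. \<Sum>j<n. \<Sum>a<n. \<Sum>m<n. M $$ (r, k * n + j) *
        (unity_char n (int a * (int k - int ?k)) * unity_char n (int m * (int j - int ?j))))"
      by (rule sum_swap_pairs)
    also have "\<dots> = (\<Sum>k<n. \<Sum>j<n. M $$ (r, k * n + j) *
        ((\<Sum>a<n. unity_char n (int a * (int k - int ?k)))
          * (\<Sum>m<n. unity_char n (int m * (int j - int ?j)))))"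
      by (intro sum.cong refl) (simp only: sum_distrib_left[symmetric] sum_distrib_right[symmetric])
    also have "\<dots> = (\<Sum>k<n. \<Sum>j<n. if k = ?k then if j = ?j then
        M $$ (r, k * n + j) * of_nat (n ^ 2) else 0 else 0)"
      using lt by (intro sum.cong refl) (simp add: orth power2_eq_square)
    also have "\<dots> = M $$ (r, ?k * n + ?j) * of_nat (n ^ 2)"
      using lt by (simp add: if_distrib[of "\<lambda>x. sum x _"] sum.If_cases)
    finally show ?thesis by simp
  qed
  show ?thesis
  proof (rule eq_matI)
    fix r c assume "r < dim_row B" "c < dim_col B"
    then have rc: "r < n ^ 2" "c < n ^ 2" using assms(2) by auto
    then have "n > 0" by (cases n) auto
    then have "of_nat (n ^ 2) \<noteq> (0 :: complex)" by simp
    moreover have "of_nat (n ^ 2) * A $$ (r, c) = of_nat (n ^ 2) * B $$ (r, c)"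
      unfolding inv[OF assms(1) rc, symmetric] inv[OF assms(2) rc, symmetric] assms(3) ..
    ultimately show "A $$ (r, c) = B $$ (r, c)" by simp
  qed (use assms in auto)
qed

section \<open>The \<open>n\<close>-th power as the antipodal shift\<close>

lemma transition_mat_pow_eq_antipodal_shift:
  assumes "s \<ge> 1" "n = 2 ^ s"
  shows "transition_mat n ^\<^sub>m n = block_shift_mat n (\<lambda>_. n div 2)"
proof (rule mat_eq_if_wave_vecs_eq)
  have n: "even n" "n > 0" using assms by auto
  fix a m
  \<comment> \<open>The eigenvalue of the antipodal shift on the wave: w^(m n / 2) = exp(pi i m) =
    (-1)^m.\<close>
  have half: "unity_char n (m * int (n div 2)) = (if even m then 1 else - 1)"
  proof -
    have "unity_char n (m * int (n div 2)) = cis (pi * of_int m)"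
      using n by (auto elim!: evenE simp: unity_char_def)
    moreover have "cis (pi * (2 * of_int b)) = 1" for b
      using cis_multiple_2pi[of "of_int b"] by (simp add: mult_ac)
    ultimately show ?thesis
      by (auto elim!: evenE oddE simp: distrib_left cis_mult[symmetric])
  qed
  \<comment> \<open>Since \<open>n\<close> is a power of two, every odd \<open>m\<close> is coprime
    to it, so the two sign products cover all cases.\<close>
  have "(\<Prod>i<n. wave_sign n (a + int i * m) m) = (if even m then 1 else - 1)"
    using n assms by (auto intro!: prod_wave_sign_even prod_wave_sign_coprime)
  moreover have "wave_vec n (a + int n * m) m = wave_vec n a m"
    by (rule wave_vec_cong) simp
  ultimately have "transition_mat n ^\<^sub>m n *\<^sub>v wave_vec n a m
      = (if even m then 1 else - 1) \<cdot>\<^sub>v wave_vec n a m"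
    by (simp add: transition_mat_pow_mult_wave_vec)
  also have "\<dots> = block_shift_mat n (\<lambda>_. n div 2) *\<^sub>v wave_vec n a m"
    by (rule eq_vecI) (simp_all add: block_shift_mat_mult_wave_vec half
        carrier_vecD[OF wave_vec_carrier] carrier_matD[OF block_shift_mat_carrier] del: index_mult_mat_vec)
  finally show "transition_mat n ^\<^sub>m n *\<^sub>v wave_vec n a m
    = block_shift_mat n (\<lambda>_. n div 2) *\<^sub>v wave_vec n a m" .
qed (auto intro!: pow_carrier_mat)


text \<open>On each wave the shift has the eigenvalue w^(m n / 2), whose square is w^(m n) =
  1.\<close>

lemma block_shift_mat_half_square:
  assumes "even n" "n > 0"
  shows "block_shift_mat n (\<lambda>_. n div 2) * block_shift_mat n (\<lambda>_. n div 2) = 1\<^sub>m (n ^ 2)"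
proof (rule mat_eq_if_wave_vecs_eq)
  let ?B = "block_shift_mat n (\<lambda>_. n div 2)"
  fix a m
  have sq: "unity_char n (m * int (n div 2)) * unity_char n (m * int (n div 2)) = 1"
    using assms by (auto elim!: evenE simp: unity_char_eq_1_iff simp flip: unity_char_add)
  have B: "?B *\<^sub>v wave_vec n a m = unity_char n (m * int (n div 2)) \<cdot>\<^sub>v wave_vec n a m"
    by (rule eq_vecI) (simp_all add: block_shift_mat_mult_wave_vec
        carrier_vecD[OF wave_vec_carrier] carrier_matD[OF block_shift_mat_carrier] del: index_mult_mat_vec)
  have "(?B * ?B) *\<^sub>v wave_vec n a m = ?B *\<^sub>v (?B *\<^sub>v wave_vec n a m)"
    by (rule assoc_mult_mat_vec[OF block_shift_mat_carrier block_shift_mat_carrier wave_vec_carrier])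
  also have "\<dots> = wave_vec n a m"
    unfolding B mult_mat_vec[OF block_shift_mat_carrier wave_vec_carrier]
    by (simp add: smult_smult_assoc sq)
  finally show "(?B * ?B) *\<^sub>v wave_vec n a m = 1\<^sub>m (n ^ 2) *\<^sub>v wave_vec n a m" by simp
qed (auto intro!: mult_carrier_mat[OF block_shift_mat_carrier])

section \<open>Exponents at which the power is the identity\<close>

lemma pow_mat_add:
  assumes "A \<in> carrier_mat n n"
  shows "A ^\<^sub>m (k + l) = A ^\<^sub>m k * A ^\<^sub>m l"
proof (induction l)
  case 0
  show ?case using right_mult_one_mat[OF pow_carrier_mat[OF assms]] assms by simp
next
  case (Suc l)
  then show ?case
    using assoc_mult_mat[OF pow_carrier_mat[OF assms] pow_carrier_mat[OF assms] assms] by simp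
qed

text \<open>The wave with parameters \<open>a = 0\<close>, \<open>m = 1\<close> is moved to \<open>a = t\<close>, up to a sign, and waves
  with \<open>a\<close> incongruent modulo \<open>n\<close> are not proportional.\<close>

lemma dvd_if_transition_mat_pow_eq_one:
  assumes "n \<ge> 2" "transition_mat n ^\<^sub>m t = 1\<^sub>m (n ^ 2)"
  shows "n dvd t"
proof -
  define c where "c = (\<Prod>i<t. wave_sign n (0 + int i * 1) 1)"
  have eq: "wave_vec n 0 1 = c \<cdot>\<^sub>v wave_vec n (int t) 1"
    using transition_mat_pow_mult_wave_vec[of n t 0 1] assms(2) by (simp add: c_def)
  have entries: "wave_vec n 0 1 $ (k * n + 0) = c * wave_vec n (int t) 1 $ (k * n + 0)" if "k < n" for k
    using arc_index_less_square[OF that, of 0] assms(1)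
    by (subst eq) (simp add: carrier_vecD[OF wave_vec_carrier])
  then have "1 = c * unity_char n (int t * int k)" if "k < n" for k
    using entries[OF that] index_wave_vec[OF that, of 0] assms(1) by simp
  \<comment> \<open>Block 0 gives c = 1, and block 1, which exists because \<open>n\<close> is at
    least 2, then gives w^t = 1.\<close>
  from this[of 0] this[of 1] have "unity_char n (int t) = 1" using assms(1) by simp
  then show ?thesis using assms(1) by (simp add: unity_char_eq_1_iff)
qed

section \<open>State transfer at time \<open>n\<close> and period \<open>2 * n\<close>\<close>

theorem theorem8p3:
  fixes G :: "('a,'b) pre_digraph" and \<pi> :: "'a set set" and d n s :: nat
  assumes "regular_digraph G d"
    and "card (verts G) = 2 * n"
    and "equitable_partition G \<pi>"
    and "digraph_iso (quotient_graph G \<pi>) (complete_loop_digraph n)"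
    and "s \<ge> 1"
    and "n = 2 ^ s"
  shows "(\<forall>a \<in> arcs (complete_loop_digraph n).
            perfect_state_transfer (transition_mat n) n
              (arc_state n a) (arc_state n (antipodal_arc n a)) \<and>
            (cmod ((transition_mat n ^\<^sub>m n) $$ (arc_index n (antipodal_arc n a), arc_index n a)))\<^sup>2 = 1 \<and>
            transfer_fidelity (transition_mat n) n
              (arc_state n a) (arc_state n (antipodal_arc n a)) = 1)
       \<and> transition_mat n ^\<^sub>m (2 * n) = 1\<^sub>m (n ^ 2)
       \<and> mat_period (transition_mat n) = 2 * n"
proof (intro conjI ballI)
  let ?U = "transition_mat n" and ?B = "block_shift_mat n (\<lambda>_. n div 2)"
  have n: "even n" "n > 0" "n \<ge> 2" using assms(5,6) by (auto simp: self_le_power)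
  have Un: "?U ^\<^sub>m n = ?B" by (rule transition_mat_pow_eq_antipodal_shift[OF assms(5,6)])
  show U2n: "?U ^\<^sub>m (2 * n) = 1\<^sub>m (n ^ 2)"
    unfolding mult_2 pow_mat_add[OF transition_mat_carrier] Un
    by (rule block_shift_mat_half_square[OF n(1,2)])
  have "?B \<noteq> 1\<^sub>m (n ^ 2)"
  proof
    assume "?B = 1\<^sub>m (n ^ 2)"
    \<comment> \<open>The only 1 in row 0 of the shift is in column n / 2, which is not 0.\<close>
    then have "?B $$ (0, 0) = 1\<^sub>m (n ^ 2) $$ (0, 0)" by simp
    then show False using n by (auto simp: block_shift_mat_def elim!: evenE)
  qed
  then have "2 * n \<le> t" if t: "0 < t" "?U ^\<^sub>m t = 1\<^sub>m (n ^ 2)" for t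
  proof -
    obtain q where q: "t = n * q"
      using dvd_if_transition_mat_pow_eq_one[OF n(3) t(2)] by (elim dvdE)
    \<comment> \<open>The value 0 contradicts t > 0, and the value 1 would make the antipodal shift
      the identity.\<close>
    have "q \<noteq> 0" "q \<noteq> 1" using q t Un \<open>?B \<noteq> 1\<^sub>m (n ^ 2)\<close> by auto
    then show ?thesis using q by simp
  qed
  then show "mat_period ?U = 2 * n"
    unfolding mat_period_def carrier_matD[OF transition_mat_carrier]
    using U2n n(2) by (intro Least_equality) auto
  fix a assume "a \<in> arcs (complete_loop_digraph n)"
  then obtain i j where a: "a = (i, j)" and ij: "i < n" "j < n"
    by (auto simp: complete_loop_digraph_def)
  let ?b = "antipodal_arc n a"
  have b: "?b = (i, (j + n div 2) mod n)" by (simp add: a)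
  have state: "arc_state n (k, l) = unit_vec (n ^ 2) (k * n + l)" if "k < n" "l < n" for k l
  proof (rule eq_vecI)
    fix r assume "r < dim_vec (unit_vec (n ^ 2) (k * n + l) :: complex vec)"
    then have r: "r < n ^ 2" by simp
    have "r div n = k \<and> r mod n = l \<longleftrightarrow> r = k * n + l"
      using that by (auto simp: mult.commute)
    then show "arc_state n (k, l) $ r = unit_vec (n ^ 2) (k * n + l) $ r"
      using r that arc_index_less_square[OF that] n(2)
      by (auto simp: tensor_vec_def power2_eq_square div_less_of_less_square unit_vec_def
          less_mult_imp_div_less)
  qed (simp add: tensor_vec_def power2_eq_square)
  have lt: "arc_index n a < n ^ 2" "arc_index n ?b < n ^ 2"
    using ij n(2) by (auto simp: a intro!: arc_index_less_square)
  \<comment> \<open>The row of the antipodal arc has its 1 at the arc shifted once more by n / 2,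
    which is the original arc because two half turns cancel.\<close>
  have twice: "((j + n div 2) mod n + n div 2) mod n = j"
  proof -
    have "j + n div 2 + n div 2 = j + n" using n(1) by (auto elim!: evenE)
    then have "((j + n div 2) mod n + n div 2) mod n = (j + n) mod n"
      by (simp only: mod_add_left_eq)
    then show ?thesis using ij by simp
  qed
  have entry: "?B $$ (arc_index n ?b, arc_index n a) = 1"
    using lt ij n(2) twice by (simp add: a block_shift_mat_def)
  show "(cmod ((?U ^\<^sub>m n) $$ (arc_index n ?b, arc_index n a)))\<^sup>2 = 1"
    by (simp add: Un entry)
  have "(?B *\<^sub>v arc_state n a) \<bullet>c arc_state n ?b = ?B $$ (arc_index n ?b, arc_index n a)"
  proof -
    have st: "arc_state n a = unit_vec (n ^ 2) (arc_index n a)"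
        "arc_state n ?b = unit_vec (n ^ 2) (arc_index n ?b)"
      using ij n(2) by (simp_all add: a state del: arc_state.simps)
    \<comment> \<open>Basis states are real, so the Hermitian product is a plain matrix
      entry.\<close>
    have conj: "conjugate (unit_vec (n ^ 2) k) = (unit_vec (n ^ 2) k :: complex vec)" for k
      by (rule eq_vecI) (auto simp: unit_vec_def)
    show ?thesis
      unfolding st conj using lt
      by (simp add: scalar_prod_right_unit carrier_matD[OF block_shift_mat_carrier])
  qed
  then show "transfer_fidelity ?U n (arc_state n a) (arc_state n ?b) = 1"
    by (simp add: transfer_fidelity_def Un entry)
  then show "perfect_state_transfer ?U n (arc_state n a) (arc_state n ?b)"
    by (simp add: perfect_state_transfer_def)
qed

end
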